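(* Let $k$ be a field, $A$ a commutative $k$-algebra, and let $(\mathbb{A},\phi_{i,j},\longleftarrow,\leq)$ be a standard monomial theory with straightening relations for $A$ on the multiset $\mathbb{A}=\mathbb{A}_1\sqcup\cdots\sqcup\mathbb{A}_n$. Let $\mathcal{R}$ be the kernel of the natural map $\mathsf{S}(\mathbb{A})\to A$, where $\mathsf{S}(\mathbb{A})$ is the symmetric (polynomial) algebra over $k$ with set of indeterminates $\mathbb{A}$. If all weakly standard monomials are standard and the ideal $\mathcal{R}$ is homogeneous for the total degree of monomials, then $\mathcal{R}$ is generated in degree two (i.e. by homogeneous elements of total degree two).
   Context: Let $\mathbb{A}_1,\dots,\mathbb{A}_n$ be disjoint finite subsets of $A$, and $\mathbb{A}=\mathbb{A}_1\sqcup\cdots\sqcup\mathbb{A}_n$ (called a multiset). A formal monomial is a monomial in the elements of $\mathbb{A}$ in the free associative algebra on $\mathbb{A}$; a monomial is a commutative monomial in $\mathsf{S}(\mathbb{A})$. The shape of $a\in\mathbb{A}_i$ is $i$; the shape of a formal monomial $a_1a_2\cdots a_N$ is $(i_1,\dots,i_N)$, where $i_h$ is the shape of $a_h$. Let $\longleftarrow$ be a binary relation on $\mathbb{A}$ which is antisymmetric and transitive when restricted to each $\mathbb{A}_i$. A formal monomial $a_1\cdots a_N$ is weakly standard if $a_1\longleftarrow a_2\longleftarrow\cdots\longleftarrow a_N$. For all $i,j$ let $\phi_{i,j}$ (swap maps) be a map from the set of weakly standard formal monomials of shape $(i,j)$ to the set of weakly standard formal monomials of shape $(j,i)$, such that $\phi_{i,i}=\mathrm{Id}$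 and $\phi_{i,j}\phi_{j,i}=\mathrm{Id}$. Swapping an adjacent pair $a_ja_{j+1}$ in a weakly standard formal monomial $a_1\cdots a_N$ means replacing that pair by its image under the appropriate swap map; if the result is weakly standard one can swap again, and so on. A formal monomial is standard if its shape is a non-decreasing sequence, it is weakly standard, and all formal monomials obtained from it by repeated swaps are weakly standard. A monomial in $\mathsf{S}(\mathbb{A})$ is weakly standard (resp. standard) if it is the image of a weakly standard (resp. standard) formal monomial. $(\mathbb{A},\phi_{i,j},\longleftarrow)$ is a standard monomial theory on the multiset $\mathbb{A}$ for $A$ if the images in $A$ of the standard monomials of $\mathsf{S}(\mathbb{A})$ are all distinct and form a $k$-basis of $A$. Let $\leq$ be a (partial) order on commutative monomials in $\mathbb{A}$ such that: (i) if $m'\leq m''$ then $mm'\leq mm''$ for all monomials $m$; (ii) for every monomial $m$ the set of monomials $m'$ with $m\leq m'$ is finite. For a non-standard monomial $m'$ there is a unique expression $m'=\sum_m a_m m$ in $A$ as a $k$-linear combination of standard monomials $m$; it is called a straightening relation for $m'$ if $m'\leq m$ whenever $a_m\neq0$. If every non-standard monomial has a straightening relation, then $(\mathbb{A},\phi_{i,j},\longleftarrow,\leq)$ is a standard monomial theory with straightening relations for $A$. *)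

theory Defs
  imports Complex_Main "HOL-Library.Multiset" "HOL-Library.Poly_Mapping" "HOL-Library.Disjoint_Sets"
    "HOL-Library.FuncSet"
begin

text \<open>
  A monomial in commuting indeterminates taken from \<open>'a\<close> is a multiset over \<open>'a\<close>
  (its product is \<open>+\<close>, its total degree is \<open>size\<close>), and a polynomial with coefficients
  in \<open>'k\<close> is a finitely supported function from monomials to \<open>'k\<close>; the product of
  \<open>Poly_Mapping\<close> is convolution.  A formal monomial is a list.
\<close>

type_synonym ('a, 'k) mpoly = "'a multiset \<Rightarrow>\<^sub>0 'k"

definition homogeneous :: "nat \<Rightarrow> ('a, 'k::zero) mpoly \<Rightarrow> bool" where
  "homogeneous d p \<longleftrightarrow> (\<forall>m\<in>Poly_Mapping.keys p. size m = d)"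

definition hom_component :: "nat \<Rightarrow> ('a, 'k::comm_monoid_add) mpoly \<Rightarrow> ('a, 'k) mpoly" where
  "hom_component d p =
     (\<Sum>m | m \<in> Poly_Mapping.keys p \<and> size m = d.
        Poly_Mapping.single m (Poly_Mapping.lookup p m))"

definition homogeneous_subspace :: "('a, 'k::comm_monoid_add) mpoly set \<Rightarrow> bool" where
  "homogeneous_subspace I \<longleftrightarrow> (\<forall>p\<in>I. \<forall>d. hom_component d p \<in> I)"

definition monomials_in :: "'a set \<Rightarrow> 'a multiset set" where
  "monomials_in X = {m. set_mset m \<subseteq> X}"

text \<open>The polynomial ring \<open>S(X)\<close>, as a subring of the polynomials in all elements of \<open>'a\<close>.
  Ideals below are ideals of \<open>S(X)\<close>, not of the ambient ring.\<close>

definition polys_in :: "'a set \<Rightarrow> ('a, 'k::zero) mpoly set" where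
  "polys_in X = {p. Poly_Mapping.keys p \<subseteq> monomials_in X}"

definition ideal_in :: "'a set \<Rightarrow> ('a, 'k::comm_ring_1) mpoly set \<Rightarrow> bool" where
  "ideal_in X I \<longleftrightarrow> I \<subseteq> polys_in X \<and> 0 \<in> I \<and> (\<forall>p\<in>I. \<forall>q\<in>I. p + q \<in> I) \<and>
     (\<forall>p\<in>polys_in X. \<forall>q\<in>I. p * q \<in> I)"

definition generated_in_degree ::
  "'a set \<Rightarrow> nat \<Rightarrow> ('a, 'k::comm_ring_1) mpoly set \<Rightarrow> bool" where
  "generated_in_degree X d I \<longleftrightarrow>
     (\<exists>G\<subseteq>polys_in X. (\<forall>g\<in>G. homogeneous d g) \<and> I = ideal_in X hull G)"

locale comm_algebra = vector_space scale
  for scale :: "'k::field \<Rightarrow> 'a::comm_ring_1 \<Rightarrow> 'a" +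
  assumes scale_mult_left: "scale c (x * y) = scale c x * y"
begin

definition eval_mpoly :: "('a, 'k) mpoly \<Rightarrow> 'a" where
  "eval_mpoly p = (\<Sum>m\<in>Poly_Mapping.keys p. scale (Poly_Mapping.lookup p m) (prod_mset m))"

definition relations_ideal :: "'a set \<Rightarrow> ('a, 'k) mpoly set" where
  "relations_ideal X = {p \<in> polys_in X. eval_mpoly p = 0}"

end

locale shaped_set =
  fixes n :: nat and \<A> :: "nat \<Rightarrow> 'a set"
  assumes finite_parts: "i \<in> {1..n} \<Longrightarrow> finite (\<A> i)"
    and disjoint_parts: "disjoint_family_on \<A> {1..n}"
begin

definition gens :: "'a set" where
  "gens = (\<Union>i\<in>{1..n}. \<A> i)"

definition shape :: "'a \<Rightarrow> nat" where
  "shape a = (THE i. i \<in> {1..n} \<and> a \<in> \<A> i)"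

end

locale shaped_relation = shaped_set n \<A>
  for n :: nat and \<A> :: "nat \<Rightarrow> 'a set" +
  fixes rel :: "'a \<Rightarrow> 'a \<Rightarrow> bool" (infix "\<longleftarrow>" 50)
  assumes antisym_parts: "i \<in> {1..n} \<Longrightarrow> antisymp_on (\<A> i) (\<longleftarrow>)"
    and trans_parts: "i \<in> {1..n} \<Longrightarrow> transp_on (\<A> i) (\<longleftarrow>)"
begin

definition weakly_standard_formal :: "'a list \<Rightarrow> bool" where
  "weakly_standard_formal xs \<longleftrightarrow> xs \<in> lists gens \<and> successively (\<longleftarrow>) xs"

definition weakly_standard :: "'a multiset \<Rightarrow> bool" where
  "weakly_standard m \<longleftrightarrow> (\<exists>xs. mset xs = m \<and> weakly_standard_formal xs)"

definition weakly_standard_of_shape :: "nat list \<Rightarrow> 'a list set" where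
  "weakly_standard_of_shape is = {xs. weakly_standard_formal xs \<and> map shape xs = is}"

end

locale swap_maps = shaped_relation n \<A> rel
  for n :: nat and \<A> :: "nat \<Rightarrow> 'a set" and rel :: "'a \<Rightarrow> 'a \<Rightarrow> bool" (infix "\<longleftarrow>" 50) +
  fixes \<phi> :: "nat \<Rightarrow> nat \<Rightarrow> 'a list \<Rightarrow> 'a list"
  assumes swap_maps_to: "\<lbrakk>i \<in> {1..n}; j \<in> {1..n}\<rbrakk> \<Longrightarrow>
      \<phi> i j \<in> weakly_standard_of_shape [i, j] \<rightarrow> weakly_standard_of_shape [j, i]"
    and swap_same: "\<lbrakk>i \<in> {1..n}; xs \<in> weakly_standard_of_shape [i, i]\<rbrakk> \<Longrightarrow> \<phi> i i xs = xs"
    and swap_swap: "\<lbrakk>i \<in> {1..n}; j \<in> {1..n}; xs \<in> weakly_standard_of_shape [j, i]\<rbrakk> \<Longrightarrow>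
      \<phi> i j (\<phi> j i xs) = xs"
begin

inductive swap_step :: "'a list \<Rightarrow> 'a list \<Rightarrow> bool" where
  "weakly_standard_formal (us @ [a, b] @ vs) \<Longrightarrow>
     swap_step (us @ [a, b] @ vs) (us @ \<phi> (shape a) (shape b) [a, b] @ vs)"

definition standard_formal :: "'a list \<Rightarrow> bool" where
  "standard_formal xs \<longleftrightarrow> sorted (map shape xs) \<and> weakly_standard_formal xs \<and>
     (\<forall>ys. swap_step\<^sup>*\<^sup>* xs ys \<longrightarrow> weakly_standard_formal ys)"

definition standard :: "'a multiset \<Rightarrow> bool" where
  "standard m \<longleftrightarrow> (\<exists>xs. mset xs = m \<and> standard_formal xs)"

end

locale standard_monomial_theory =
  comm_algebra scale + swap_maps n \<A> rel \<phi>
  for scale :: "'k::field \<Rightarrow> 'a::comm_ring_1 \<Rightarrow> 'a"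
    and n :: nat and \<A> :: "nat \<Rightarrow> 'a set" and rel :: "'a \<Rightarrow> 'a \<Rightarrow> bool" (infix "\<longleftarrow>" 50)
    and \<phi> :: "nat \<Rightarrow> nat \<Rightarrow> 'a list \<Rightarrow> 'a list" +
  assumes standard_distinct: "inj_on prod_mset {m. standard m}"
    and standard_independent: "independent (prod_mset ` {m. standard m})"
    and standard_span: "span (prod_mset ` {m. standard m}) = UNIV"
begin

text \<open>Since the standard monomials form a basis, the first two conditions determine \<open>p\<close>.\<close>

definition straightening_relation ::
  "('a multiset \<Rightarrow> 'a multiset \<Rightarrow> bool) \<Rightarrow> 'a multiset \<Rightarrow> ('a, 'k) mpoly \<Rightarrow> bool" where
  "straightening_relation le m' p \<longleftrightarrow>
     Poly_Mapping.keys p \<subseteq> {m. standard m} \<and> prod_mset m' = eval_mpoly p \<and>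
     (\<forall>m\<in>Poly_Mapping.keys p. le m' m)"

end

locale standard_monomial_theory_straightening =
  standard_monomial_theory scale n \<A> rel \<phi>
  for scale :: "'k::field \<Rightarrow> 'a::comm_ring_1 \<Rightarrow> 'a"
    and n :: nat and \<A> :: "nat \<Rightarrow> 'a set" and rel :: "'a \<Rightarrow> 'a \<Rightarrow> bool" (infix "\<longleftarrow>" 50)
    and \<phi> :: "nat \<Rightarrow> nat \<Rightarrow> 'a list \<Rightarrow> 'a list" +
  fixes le :: "'a multiset \<Rightarrow> 'a multiset \<Rightarrow> bool" (infix "\<preceq>" 50)
  assumes le_refl: "reflp_on (monomials_in gens) (\<preceq>)"
    and le_antisym: "antisymp_on (monomials_in gens) (\<preceq>)"
    and le_trans: "transp_on (monomials_in gens) (\<preceq>)"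
    and le_mult: "\<lbrakk>m \<in> monomials_in gens; m' \<in> monomials_in gens; m'' \<in> monomials_in gens; m' \<preceq> m''\<rbrakk>
      \<Longrightarrow> m + m' \<preceq> m + m''"
    and finite_above: "m \<in> monomials_in gens \<Longrightarrow> finite {m' \<in> monomials_in gens. m \<preceq> m'}"
    and straightening: "\<lbrakk>m' \<in> monomials_in gens; \<not> standard m'\<rbrakk>
      \<Longrightarrow> \<exists>p. straightening_relation (\<preceq>) m' p"

end

theory Submission imports Defs begin

text \<open>
  The ideal generated by the quadratic relations already reduces every monomial to a combination
  of standard ones.  Indeed, ordering the factors first by shape and then by \<open>\<longleftarrow>\<close> shows that a
  monomial all of whose degree-two divisors are standard is weakly standard, hence standard.  So a
  non-standard monomial is \<open>m' + {#a, b#}\<close> with \<open>{#a, b#}\<close> non-standard; replacing \<open>{#a, b#}\<close> by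
  the degree-two part of its straightening relation (a relation because the ideal of relations is
  homogeneous) gives strictly larger monomials, and the process stops because only finitely many
  monomials lie above a given one.  A relation thus reduces to a combination of standard monomials
  that vanishes in the algebra, which is zero by independence.
\<close>

section \<open>Polynomials, homogeneous components and ideals\<close>

lemma poly_mapping_eq_sum_single:
  fixes f :: "'a \<Rightarrow>\<^sub>0 'b::comm_monoid_add"
  shows "(\<Sum>k\<in>Poly_Mapping.keys f. Poly_Mapping.single k (Poly_Mapping.lookup f k)) = f"
  by (rule poly_mapping_eqI) (auto simp: lookup_sum lookup_single when_def in_keys_iff)

text \<open>The single-term case concerns only the terms of the given \<open>f\<close>, so a
  hypothesis about the keys of \<open>f\<close> remains available there.\<close>

lemma poly_mapping_add_induct [case_names zero single add]:
  fixes f :: "'a \<Rightarrow>\<^sub>0 'b::comm_monoid_add"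
  assumes "P 0"
    and "\<And>k. k \<in> Poly_Mapping.keys f \<Longrightarrow> P (Poly_Mapping.single k (Poly_Mapping.lookup f k))"
    and "\<And>g h. P g \<Longrightarrow> P h \<Longrightarrow> P (g + h)"
  shows "P f"
proof -
  have "P (\<Sum>k\<in>K. Poly_Mapping.single k (Poly_Mapping.lookup f k))"
    if "finite K" "K \<subseteq> Poly_Mapping.keys f" for K
    using that by (induction K rule: finite_induct) (auto intro: assms)
  from this[of "Poly_Mapping.keys f"] show ?thesis
    by (simp add: poly_mapping_eq_sum_single)
qed

lemma lookup_hom_component:
  "Poly_Mapping.lookup (hom_component d p) m = (if size m = d then Poly_Mapping.lookup p m else 0)"
  by (auto simp: hom_component_def lookup_sum lookup_single when_def in_keys_iff)

lemma homogeneous_hom_component: "homogeneous d (hom_component d p)"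
  by (auto simp: homogeneous_def in_keys_iff lookup_hom_component split: if_splits)

lemma keys_hom_component:
  "Poly_Mapping.keys (hom_component d p) = {m \<in> Poly_Mapping.keys p. size m = d}"
  by (auto simp: in_keys_iff lookup_hom_component split: if_splits)

lemma hom_component_diff:
  fixes p q :: "('a, 'k::ab_group_add) mpoly"
  shows "hom_component d (p - q) = hom_component d p - hom_component d q"
  by (rule poly_mapping_eqI) (simp add: lookup_hom_component lookup_minus)

lemma hom_component_single:
  "hom_component d (Poly_Mapping.single m c) = (if size m = d then Poly_Mapping.single m c else 0)"
  by (rule poly_mapping_eqI) (auto simp: lookup_hom_component lookup_single when_def)

lemma add_in_polys_in:
  "p \<in> polys_in X \<Longrightarrow> q \<in> polys_in X \<Longrightarrow> p + q \<in> polys_in X"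
  using keys_add[of p q] by (auto simp: polys_in_def)

lemma single_in_polys_in: "m \<in> monomials_in X \<Longrightarrow> Poly_Mapping.single m c \<in> polys_in X"
  by (simp add: polys_in_def)

lemma mult_in_polys_in:
  fixes p q :: "('a, 'k::comm_ring_1) mpoly"
  shows "p \<in> polys_in X \<Longrightarrow> q \<in> polys_in X \<Longrightarrow> p * q \<in> polys_in X"
  using keys_mult[of p q] by (fastforce simp: polys_in_def monomials_in_def)

lemma const_in_polys_in: "Poly_Mapping.single 0 c \<in> polys_in X"
  by (simp add: polys_in_def monomials_in_def)

lemma ideal_in_add: "ideal_in X I \<Longrightarrow> p \<in> I \<Longrightarrow> q \<in> I \<Longrightarrow> p + q \<in> I"
  by (simp add: ideal_in_def)

lemma ideal_in_mult: "ideal_in X I \<Longrightarrow> p \<in> polys_in X \<Longrightarrow> q \<in> I \<Longrightarrow> p * q \<in> I"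
  by (simp add: ideal_in_def)

section \<open>Sorting a multiset, and shapes of generators\<close>

text \<open>Insertion sort. Comparability is demanded only of pairs dividing \<open>m\<close>, so
  \<open>R a a\<close> is demanded only when \<open>a\<close> has multiplicity at least two; this
  suits a relation that may fail to be reflexive.\<close>

lemma sorted_wrt_permutation_exists:
  assumes "transp_on (set_mset m) R" and "\<And>a b. {#a, b#} \<subseteq># m \<Longrightarrow> R a b \<or> R b a"
  shows "\<exists>xs. mset xs = m \<and> sorted_wrt R xs"
  using assms
proof (induction m)
  case empty
  then show ?case by simp
next
  case (add a m)
  have "transp_on (set_mset m) R"
    using add.prems(1) by (rule transp_on_subset) auto
  moreover have "R x y \<or> R y x" if "{#x, y#} \<subseteq># m" for x y
    using that by (intro add.prems(2)) (erule subset_mset.order_trans, simp)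
  ultimately obtain xs where xs: "mset xs = m" "sorted_wrt R xs"
    using add.IH by blast
  have set_xs: "set xs = set_mset m"
    using xs(1) by auto
  have total: "R a x \<or> R x a" if "x \<in> set xs" for x
    using that set_xs by (intro add.prems(2)) auto
  have trans: "R x z" if "R x y" "R y z" "x \<in> insert a (set xs)" "y \<in> insert a (set xs)"
      "z \<in> insert a (set xs)" for x y z
    using that add.prems(1) set_xs by (auto dest: transp_onD)
  \<comment> \<open>Totality gives \<open>R a z\<close> for each \<open>z\<close> in
    \<open>?zs\<close>, so transitivity through \<open>a\<close> relates every element of
    \<open>?ys\<close> to every element of \<open>?zs\<close>.\<close>
  let ?ys = "filter (\<lambda>x. R x a) xs" and ?zs = "filter (\<lambda>x. \<not> R x a) xs"
  have "sorted_wrt R (?ys @ a # ?zs)"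
    using xs(2) total trans by (auto simp: sorted_wrt_append sorted_wrt_filter)
  moreover have "mset (?ys @ a # ?zs) = add_mset a m"
    using xs(1) by (simp add: multiset_partition[symmetric])
  ultimately show ?case by blast
qed

context shaped_set
begin

lemma shape_eqI: "i \<in> {1..n} \<Longrightarrow> a \<in> \<A> i \<Longrightarrow> shape a = i"
  unfolding shape_def using disjoint_parts
  by (intro the_equality) (unfold disjoint_family_on_def, blast+)

lemma shape_part: "a \<in> gens \<Longrightarrow> shape a \<in> {1..n} \<and> a \<in> \<A> (shape a)"
  using shape_eqI by (auto simp: gens_def)

end

section \<open>The evaluation homomorphism and its kernel\<close>

context comm_algebra
begin

text \<open>Enlarging the support puts polynomials with different supports over a common index set,
  as additivity requires.\<close>

lemma eval_mpoly_superset: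
  assumes "finite K" "Poly_Mapping.keys p \<subseteq> K"
  shows "eval_mpoly p = (\<Sum>m\<in>K. scale (Poly_Mapping.lookup p m) (prod_mset m))"
  unfolding eval_mpoly_def
  by (rule sum.mono_neutral_left) (use assms in \<open>auto simp: in_keys_iff\<close>)

lemma eval_mpoly_0: "eval_mpoly 0 = 0"
  by (simp add: eval_mpoly_def)

lemma eval_mpoly_single: "eval_mpoly (Poly_Mapping.single m c) = scale c (prod_mset m)"
  by (subst eval_mpoly_superset[of "{m}"]) auto

lemma eval_mpoly_add: "eval_mpoly (p + q) = eval_mpoly p + eval_mpoly q"
proof -
  let ?K = "Poly_Mapping.keys p \<union> Poly_Mapping.keys q"
  have "eval_mpoly (p + q) = (\<Sum>m\<in>?K. scale (Poly_Mapping.lookup (p + q) m) (prod_mset m))"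
    by (rule eval_mpoly_superset) (use keys_add[of p q] in auto)
  also have "\<dots> = eval_mpoly p + eval_mpoly q"
    by (simp add: eval_mpoly_superset[of ?K] lookup_add scale_left_distrib sum.distrib)
  finally show ?thesis .
qed

lemma eval_mpoly_diff: "eval_mpoly (p - q) = eval_mpoly p - eval_mpoly q"
  using eval_mpoly_add[of "p - q" q] by simp

text \<open>Both sides are additive in \<open>p\<close> and in \<open>q\<close>, which leaves
  products of two single terms.\<close>

lemma eval_mpoly_mult: "eval_mpoly (p * q) = eval_mpoly p * eval_mpoly q"
proof (induction p rule: poly_mapping_add_induct)
  case (single k)
  let ?c = "Poly_Mapping.lookup p k"
  show ?case
  proof (induction q rule: poly_mapping_add_induct)
    case (single l)
    show ?case
      by (metis (no_types, lifting) mult_single eval_mpoly_single prod_mset.union scale_mult_left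
          mult.commute scale_scale)
  qed (simp_all add: eval_mpoly_0 eval_mpoly_add distrib_left)
qed (simp_all add: eval_mpoly_0 eval_mpoly_add distrib_right)

lemma ideal_in_relations_ideal: "ideal_in X (relations_ideal X)"
  by (auto simp: ideal_in_def relations_ideal_def eval_mpoly_0 eval_mpoly_add eval_mpoly_mult
      add_in_polys_in mult_in_polys_in) (simp add: polys_in_def)

end

section \<open>Weak standardness detected in degree two\<close>

context swap_maps
begin

lemma standard_in_gens: "standard m \<Longrightarrow> m \<in> monomials_in gens"
  by (auto simp: standard_def standard_formal_def weakly_standard_formal_def monomials_in_def)

text \<open>The underlying standard formal monomial is \<open>[a, b]\<close> or
  \<open>[b, a]\<close>. Recording the shapes along with the relation fixes the direction of
  \<open>\<longleftarrow>\<close> when the shapes differ.\<close>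

lemma standard_pair:
  assumes "standard {#a, b#}"
  shows "shape a \<le> shape b \<and> a \<longleftarrow> b \<or> shape b \<le> shape a \<and> b \<longleftarrow> a"
proof -
  obtain xs where xs: "mset xs = {#a, b#}" "standard_formal xs"
    using assms by (auto simp: standard_def)
  have "length xs = 2"
    using arg_cong[OF xs(1), of size] by simp
  then obtain x y where "xs = [x, y]"
    by (auto simp: length_Suc_conv numeral_2_eq_2)
  with xs show ?thesis
    by (auto simp: standard_formal_def weakly_standard_formal_def add_eq_conv_ex)
qed

text \<open>Since \<open>\<longleftarrow>\<close> need not be transitive across shapes, the factors
  are sorted by shape first and by \<open>\<longleftarrow>\<close> only within a shape; this
  relation is transitive, and it is total on the pairs dividing \<open>m\<close> because these are
  standard.\<close>

lemma weakly_standard_if_pairs_standard: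
  assumes m: "m \<in> monomials_in gens" and pairs: "\<And>a b. {#a, b#} \<subseteq># m \<Longrightarrow> standard {#a, b#}"
  shows "weakly_standard m"
proof -
  define R where "R a b \<longleftrightarrow> shape a < shape b \<or> shape a = shape b \<and> a \<longleftarrow> b" for a b
  have gens: "a \<in> gens" if "a \<in># m" for a
    using m that by (auto simp: monomials_in_def)
  have "transp_on (set_mset m) R"
  proof (rule transp_onI)
    fix a b c assume abc: "a \<in># m" "b \<in># m" "c \<in># m" "R a b" "R b c"
    have "a \<longleftarrow> c" if "shape a = shape b" "shape b = shape c" "a \<longleftarrow> b" "b \<longleftarrow> c"
      using transp_onD[OF trans_parts[of "shape a"], of a b c] that abc
        shape_part[OF gens] by metis
    with abc show "R a c" by (auto simp: R_def)
  qed
  moreover have "R a b \<or> R b a" if "{#a, b#} \<subseteq># m" for a b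
    using standard_pair[OF pairs[OF that]] by (auto simp: R_def)
  ultimately obtain xs where xs: "mset xs = m" "sorted_wrt R xs"
    using sorted_wrt_permutation_exists by blast
  have "successively (\<longleftarrow>) xs"
  proof (rule successively_mono[OF successively_if_sorted_wrt[OF xs(2)]])
    fix a b assume ab: "a \<in> set xs" "b \<in> set xs" "R a b"
    show "a \<longleftarrow> b"
    proof (cases "shape a = shape b")
      \<comment> \<open>Different shapes force \<open>a\<close> and \<open>b\<close> to be distinct,
        so their product divides \<open>m\<close>; being standard with
        \<open>shape a < shape b\<close>, it leaves only
        \<open>a \<longleftarrow> b\<close>.\<close>
      case False
      then have "{#a, b#} \<subseteq># m"
        using ab xs(1) by (auto simp: insert_subset_eq_iff in_diff_count)
      with standard_pair[OF pairs] False ab(3) show ?thesis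
        by (fastforce simp: R_def)
    qed (use ab in \<open>simp add: R_def\<close>)
  qed
  then show ?thesis
    using xs(1) gens by (auto simp: weakly_standard_def weakly_standard_formal_def)
qed

end

section \<open>Independence of the standard monomials\<close>

context standard_monomial_theory
begin

lemma eval_mpoly_standard_eq_0:
  assumes keys: "Poly_Mapping.keys p \<subseteq> {m. standard m}" and "eval_mpoly p = 0"
  shows "p = 0"
proof (rule ccontr)
  assume "p \<noteq> 0"
  then obtain m where m: "m \<in> Poly_Mapping.keys p"
    by (metis in_keys_iff poly_mapping_eqI lookup_zero)
  have inj: "inj_on prod_mset (Poly_Mapping.keys p)"
    using standard_distinct keys by (rule inj_on_subset)
  \<comment> \<open>Independence speaks of elements of the algebra; injectivity of
    \<open>prod_mset\<close> on the support lets the coefficients be indexed by the values of the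
    monomials.\<close>
  let ?u = "\<lambda>v. Poly_Mapping.lookup p (the_inv_into (Poly_Mapping.keys p) prod_mset v)"
  have "(\<Sum>v\<in>prod_mset ` Poly_Mapping.keys p. scale (?u v) v) = eval_mpoly p"
    unfolding eval_mpoly_def
    by (subst sum.reindex[OF inj]) (auto simp: the_inv_into_f_f[OF inj] intro!: sum.cong)
  then have "?u (prod_mset m) = 0"
    by (intro independentD[OF standard_independent, of "prod_mset ` Poly_Mapping.keys p" ?u])
      (use keys m assms(2) in auto)
  with m show False
    by (simp add: the_inv_into_f_f[OF inj] in_keys_iff)
qed

end

section \<open>Reduction to standard monomials modulo an ideal\<close>

context standard_monomial_theory_straightening
begin

text \<open>By transitivity whatever lies above \<open>y\<close> lies above \<open>x\<close>, and
  antisymmetry excludes \<open>x\<close> itself from the monomials above \<open>y\<close>. The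
  cardinality is the termination measure of the reduction.\<close>

lemma card_above_less:
  assumes "x \<in> monomials_in gens" "y \<in> monomials_in gens" "x \<preceq> y" "x \<noteq> y"
  shows "card {z \<in> monomials_in gens. y \<preceq> z} < card {z \<in> monomials_in gens. x \<preceq> z}"
proof (rule psubset_card_mono[OF finite_above])
  have "x \<notin> {z \<in> monomials_in gens. y \<preceq> z}"
    using assms le_antisym by (auto dest: antisymp_onD)
  moreover have "x \<preceq> x"
    using assms le_refl by (auto dest: reflp_onD)
  moreover have "x \<preceq> z" if "z \<in> monomials_in gens" "y \<preceq> z" for z
    using that assms transp_onD[OF le_trans] by blast
  ultimately show "{z \<in> monomials_in gens. y \<preceq> z} \<subset> {z \<in> monomials_in gens. x \<preceq> z}"
    using assms(1) by blast
qed (fact assms)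

text \<open>The ideal is a parameter so that the reduction can be run modulo any ideal containing
  the quadratic relations.\<close>

definition reducible :: "('a, 'k) mpoly set \<Rightarrow> ('a, 'k) mpoly \<Rightarrow> bool" where
  "reducible I p \<longleftrightarrow> (\<exists>q. Poly_Mapping.keys q \<subseteq> {m. standard m} \<and> p - q \<in> I)"

lemma reducible_add:
  assumes I: "ideal_in gens I" and "reducible I p" "reducible I p'"
  shows "reducible I (p + p')"
proof -
  obtain q q' where "Poly_Mapping.keys q \<subseteq> {m. standard m}" "p - q \<in> I"
    "Poly_Mapping.keys q' \<subseteq> {m. standard m}" "p' - q' \<in> I"
    using assms by (auto simp: reducible_def)
  then have "Poly_Mapping.keys (q + q') \<subseteq> {m. standard m}" "(p + p') - (q + q') \<in> I"
    using keys_add[of q q'] ideal_in_add[OF I, of "p - q" "p' - q'"] by (auto simp: algebra_simps)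
  then show ?thesis
    unfolding reducible_def by blast
qed

lemma reducible_const_mult:
  assumes I: "ideal_in gens I" and "reducible I p"
  shows "reducible I (Poly_Mapping.single 0 c * p)"
proof -
  obtain q where q: "Poly_Mapping.keys q \<subseteq> {m. standard m}" "p - q \<in> I"
    using assms by (auto simp: reducible_def)
  then have "Poly_Mapping.keys (Poly_Mapping.single 0 c * q) \<subseteq> {m. standard m}"
    using keys_mult[of "Poly_Mapping.single 0 c" q] by (auto split: if_splits)
  moreover have "Poly_Mapping.single 0 c * p - Poly_Mapping.single 0 c * q \<in> I"
    using ideal_in_mult[OF I const_in_polys_in q(2)] by (simp add: right_diff_distrib)
  ultimately show ?thesis
    unfolding reducible_def by blast
qed

lemma reducible_if_keys_reducible:
  assumes I: "ideal_in gens I"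
    and "\<And>m. m \<in> Poly_Mapping.keys p \<Longrightarrow> reducible I (Poly_Mapping.single m 1)"
  shows "reducible I p"
proof (induction p rule: poly_mapping_add_induct)
  case zero
  show ?case
    unfolding reducible_def using I by (intro exI[of _ 0]) (auto simp: ideal_in_def)
next
  case (single m)
  show ?case
    using reducible_const_mult[OF I assms(2)[OF single], of "Poly_Mapping.lookup p m"]
    by (simp add: mult_single)
qed (rule reducible_add[OF I])

lemma reducible_cong:
  assumes I: "ideal_in gens I" and "p - p' \<in> I" "reducible I p'"
  shows "reducible I p"
proof -
  obtain q where "Poly_Mapping.keys q \<subseteq> {m. standard m}" "p' - q \<in> I"
    using assms by (auto simp: reducible_def)
  then show ?thesis
    unfolding reducible_def using ideal_in_add[OF I \<open>p - p' \<in> I\<close>, of "p' - q"] by auto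
qed

text \<open>Taking the degree \<open>d\<close> part of the straightening relation keeps
  \<open>m\<close> and truncates the standard side. The result is still a relation by homogeneity of
  the ideal, and truncation creates no new monomials.\<close>

lemma homogeneous_straightening:
  assumes hom: "homogeneous_subspace (relations_ideal gens)"
    and m: "m \<in> monomials_in gens" "\<not> standard m" "size m = d"
  obtains r where "Poly_Mapping.keys r \<subseteq> {k. standard k \<and> m \<preceq> k}"
    "homogeneous d (Poly_Mapping.single m 1 - r)" "Poly_Mapping.single m 1 - r \<in> relations_ideal gens"
proof -
  obtain s where s: "straightening_relation (\<preceq>) m s"
    using straightening m by blast
  let ?p = "Poly_Mapping.single m 1 - s"
  have "Poly_Mapping.keys ?p \<subseteq> insert m (Poly_Mapping.keys s)"
    by (auto simp: in_keys_iff lookup_minus lookup_single when_def split: if_splits)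
  then have "?p \<in> relations_ideal gens"
    using s m(1) standard_in_gens
    by (auto simp: relations_ideal_def polys_in_def straightening_relation_def eval_mpoly_diff
        eval_mpoly_single)
  then have "hom_component d ?p \<in> relations_ideal gens"
    using hom by (simp add: homogeneous_subspace_def)
  moreover have "hom_component d ?p = Poly_Mapping.single m 1 - hom_component d s"
    using m(3) by (simp add: hom_component_diff hom_component_single)
  moreover have "homogeneous d (hom_component d ?p)"
    by (rule homogeneous_hom_component)
  ultimately show ?thesis
    using s by (intro that[of "hom_component d s"])
      (auto simp: keys_hom_component straightening_relation_def)
qed

text \<open>Induction on the number of monomials above \<open>m\<close>: rewriting a non-standard
  quadratic factor yields only strictly larger monomials.\<close>

lemma monomial_reducible:
  assumes std: "\<And>m. weakly_standard m \<Longrightarrow> standard m"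
    and hom: "homogeneous_subspace (relations_ideal gens)"
    and I: "ideal_in gens I" "{g \<in> relations_ideal gens. homogeneous 2 g} \<subseteq> I"
    and "m \<in> monomials_in gens"
  shows "reducible I (Poly_Mapping.single m 1)"
  using assms(5)
proof (induction "card {z \<in> monomials_in gens. m \<preceq> z}" arbitrary: m rule: less_induct)
  case less
  show ?case
  proof (cases "standard m")
    case True
    then show ?thesis
      unfolding reducible_def using I(1)
      by (intro exI[of _ "Poly_Mapping.single m 1"]) (auto simp: ideal_in_def)
  next
    case False
    then obtain a b where ab: "{#a, b#} \<subseteq># m" "\<not> standard {#a, b#}"
      using weakly_standard_if_pairs_standard[OF less.prems] std by blast
    then obtain m' where m': "m = m' + {#a, b#}"
      by (metis subset_mset.diff_add)
    have in_gens: "{#a, b#} \<in> monomials_in gens" "m' \<in> monomials_in gens"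
      using less.prems m' by (auto simp: monomials_in_def)
    have "size {#a, b#} = 2" by simp
    then obtain r where r: "Poly_Mapping.keys r \<subseteq> {k. standard k \<and> {#a, b#} \<preceq> k}"
      "homogeneous 2 (Poly_Mapping.single {#a, b#} 1 - r)"
      "Poly_Mapping.single {#a, b#} 1 - r \<in> relations_ideal gens"
      by (rule homogeneous_straightening[OF hom in_gens(1) ab(2)])
    have "Poly_Mapping.single m' 1 * (Poly_Mapping.single {#a, b#} 1 - r) \<in> I"
      using ideal_in_mult[OF I(1) single_in_polys_in[OF in_gens(2)]] I(2) r(2,3) by blast
    then have "Poly_Mapping.single m 1 - Poly_Mapping.single m' 1 * r \<in> I"
      by (simp only: right_diff_distrib mult_single m' mult_1)
    moreover have "reducible I (Poly_Mapping.single m' 1 * r)"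
    proof (rule reducible_if_keys_reducible[OF I(1)])
      fix k assume "k \<in> Poly_Mapping.keys (Poly_Mapping.single m' 1 * r)"
      then obtain l where l: "l \<in> Poly_Mapping.keys r" "k = m' + l"
        using keys_mult[of "Poly_Mapping.single m' 1" r] by (auto split: if_splits)
      \<comment> \<open>The monomial \<open>l\<close> is standard and \<open>{#a, b#}\<close> is
        not, so they differ; cancelling \<open>m'\<close> gives \<open>k \<noteq> m\<close>, which
        makes the increase strict.\<close>
      then have "l \<in> monomials_in gens" "l \<noteq> {#a, b#}"
        using r(1) standard_in_gens ab(2) by auto
      moreover from this have "k \<in> monomials_in gens" "k \<noteq> m"
        using l in_gens by (auto simp: m' monomials_in_def)
      moreover have "m \<preceq> k"
        using le_mult[OF in_gens(2,1) \<open>l \<in> monomials_in gens\<close>] l r(1) by (auto simp: m')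
      ultimately show "reducible I (Poly_Mapping.single k 1)"
        using less card_above_less by blast
    qed
    ultimately show ?thesis
      by (rule reducible_cong[OF I(1)])
  qed
qed

lemma relations_ideal_generated_in_degree_2:
  assumes std: "\<And>m. weakly_standard m \<Longrightarrow> standard m"
    and hom: "homogeneous_subspace (relations_ideal gens)"
  shows "generated_in_degree gens 2 (relations_ideal gens)"
proof -
  let ?G = "{g \<in> relations_ideal gens. homogeneous 2 g}"
  have "relations_ideal gens = ideal_in gens hull ?G"
  proof (rule hull_unique[symmetric])
    fix I assume G: "?G \<subseteq> I" and I: "ideal_in gens I"
    show "relations_ideal gens \<subseteq> I"
    proof
      \<comment> \<open>An arbitrary ideal \<open>I\<close> above \<open>?G\<close> may contain
        non-relations. Reducing modulo the intersection makes \<open>p - q\<close> a relation, so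
        that \<open>q\<close> vanishes in the algebra along with \<open>p\<close>.\<close>
      have I': "ideal_in gens (I \<inter> relations_ideal gens)"
        using I ideal_in_relations_ideal[of gens] unfolding ideal_in_def by blast
      fix p assume p: "p \<in> relations_ideal gens"
      have "reducible (I \<inter> relations_ideal gens) p"
      proof (rule reducible_if_keys_reducible[OF I'])
        fix m assume "m \<in> Poly_Mapping.keys p"
        with p have "m \<in> monomials_in gens"
          by (auto simp: relations_ideal_def polys_in_def)
        with G show "reducible (I \<inter> relations_ideal gens) (Poly_Mapping.single m 1)"
          by (intro monomial_reducible[OF std hom I']) auto
      qed
      then obtain q where q: "Poly_Mapping.keys q \<subseteq> {m. standard m}" "p - q \<in> I \<inter> relations_ideal gens"
        by (auto simp: reducible_def)
      then have "eval_mpoly q = 0"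
        using p by (auto simp: relations_ideal_def eval_mpoly_diff)
      with q(1) have "q = 0"
        by (rule eval_mpoly_standard_eq_0)
      with q(2) show "p \<in> I" by simp
    qed
  qed (auto intro: ideal_in_relations_ideal)
  moreover have "?G \<subseteq> polys_in gens"
    by (auto simp: relations_ideal_def)
  ultimately show ?thesis
    unfolding generated_in_degree_def by blast
qed

end

theorem corollary2p2:
  fixes scale :: "'k::field \<Rightarrow> 'a::comm_ring_1 \<Rightarrow> 'a"
    and n :: nat
    and \<A> :: "nat \<Rightarrow> 'a set"
    and rel :: "'a \<Rightarrow> 'a \<Rightarrow> bool"
    and \<phi> :: "nat \<Rightarrow> nat \<Rightarrow> 'a list \<Rightarrow> 'a list"
    and le :: "'a multiset \<Rightarrow> 'a multiset \<Rightarrow> bool"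
  assumes "standard_monomial_theory_straightening scale n \<A> rel \<phi> le"
    and "\<And>m. shaped_relation.weakly_standard n \<A> rel m \<Longrightarrow> swap_maps.standard n \<A> rel \<phi> m"
    and "homogeneous_subspace (comm_algebra.relations_ideal scale (shaped_set.gens n \<A>))"
  shows "generated_in_degree (shaped_set.gens n \<A>) 2
           (comm_algebra.relations_ideal scale (shaped_set.gens n \<A>))"
proof -
  interpret standard_monomial_theory_straightening scale n \<A> rel \<phi> le
    by (fact assms(1))
  show ?thesis
    using assms(2,3) by (rule relations_ideal_generated_in_degree_2)
qed

end
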